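(* If $\mathfrak r=\mathfrak c$, then there is a locally countable, separable, and crowded strongly anti-Urysohn space of cardinality $\mathfrak c$.
   Context: "Space" means infinite Hausdorff topological space. A space $X$ is strongly anti-Urysohn (SAU) if it has at least two non-isolated points and any two infinite closed subsets of $X$ intersect. A space is locally countable if every point has a countable neighbourhood, and crowded if it has no isolated points. A set $S$ splits a set $B$ if both $B\cap S$ and $B\setminus S$ are infinite; $\mathfrak r$ (the reaping number) is the minimum cardinality of a family $\mathcal A\subset[\omega]^\omega$ such that no $S\in[\omega]^\omega$ splits every member of $\mathcal A$. $\mathfrak c=2^\omega$. *)

theory Defs
  imports "HOL-Analysis.Analysis"
begin

unbundle cardinal_syntax

definition splits :: "nat set \<Rightarrow> nat set \<Rightarrow> bool" where
  "splits S B \<longleftrightarrow> infinite (B \<inter> S) \<and> infinite (B - S)"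

definition reaping_family :: "nat set set \<Rightarrow> bool" where
  "reaping_family \<A> \<longleftrightarrow>
     (\<forall>B\<in>\<A>. infinite B) \<and> \<not> (\<exists>S. infinite S \<and> (\<forall>B\<in>\<A>. splits S B))"

(* The cardinal is represented by card_of of a reaping family of least cardinality. Such a
   family exists, see ex_minimal_reaping_family; the value is unique up to =o. *)
definition reaping_number :: "nat set rel" where
  "reaping_number =
     |SOME \<A>. reaping_family \<A> \<and> (\<forall>\<B>. reaping_family \<B> \<longrightarrow> |\<A>| \<le>o |\<B>| )|"

definition continuum :: "(nat \<Rightarrow> bool) rel" where
  "continuum = ctwo ^c natLeq"

lemma ex_minimal_reaping_family:
  "\<exists>\<A>. reaping_family \<A> \<and> (\<forall>\<B>. reaping_family \<B> \<longrightarrow> |\<A>| \<le>o |\<B>| )"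
proof -
  have "\<not> splits S S" for S
    by (simp add: splits_def)
  then have "reaping_family {B. infinite B}"
    unfolding reaping_family_def by blast
  then have ne: "card_of ` Collect reaping_family \<noteq> {}"
    by blast
  have "\<forall>r \<in> card_of ` Collect reaping_family. Card_order r"
    by (simp add: card_of_Card_order)
  from exists_minim_Card_order[OF ne this] show ?thesis
    by simp
qed

lemma reaping_number_minimal:
  shows "\<exists>\<A>. reaping_family \<A> \<and> reaping_number = |\<A>|"
    and "\<And>\<B>. reaping_family \<B> \<Longrightarrow> reaping_number \<le>o |\<B>|"
proof -
  let ?P = "\<lambda>\<A>. reaping_family \<A> \<and> (\<forall>\<B>. reaping_family \<B> \<longrightarrow> |\<A>| \<le>o |\<B>| )"
  have P: "?P (Eps ?P)"
    by (rule someI_ex[OF ex_minimal_reaping_family])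
  have eq: "reaping_number = |Eps ?P|"
    by (rule reaping_number_def)
  show "\<exists>\<A>. reaping_family \<A> \<and> reaping_number = |\<A>|"
    using conjunct1[OF P] eq by (intro exI conjI)
  show "reaping_number \<le>o |\<B>|" if "reaping_family \<B>" for \<B>
    unfolding eq by (rule mp[OF spec[OF conjunct2[OF P]] that])
qed

(* "Space" means infinite Hausdorff topological space; the points are those of topspace X. *)
definition infinite_Hausdorff_space :: "'a topology \<Rightarrow> bool" where
  "infinite_Hausdorff_space X \<longleftrightarrow> infinite (topspace X) \<and> Hausdorff_space X"

definition isolated_points :: "'a topology \<Rightarrow> 'a set" where
  "isolated_points X = {x \<in> topspace X. openin X {x}}"

definition strongly_anti_Urysohn :: "'a topology \<Rightarrow> bool" where
  "strongly_anti_Urysohn X \<longleftrightarrow>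
     infinite_Hausdorff_space X \<and>
     (\<exists>x\<in>topspace X - isolated_points X. \<exists>y\<in>topspace X - isolated_points X. x \<noteq> y) \<and>
     (\<forall>A B. closedin X A \<and> infinite A \<and> closedin X B \<and> infinite B \<longrightarrow> A \<inter> B \<noteq> {})"

definition locally_countable_space :: "'a topology \<Rightarrow> bool" where
  "locally_countable_space X \<longleftrightarrow>
     (\<forall>x\<in>topspace X. \<exists>U N. openin X U \<and> x \<in> U \<and> U \<subseteq> N \<and> N \<subseteq> topspace X \<and> countable N)"

definition crowded_space :: "'a topology \<Rightarrow> bool" where
  "crowded_space X \<longleftrightarrow> isolated_points X = {}"

end

theory Submission
  imports Defs
begin

text \<open>
  Fix a surjection \<open>e\<close> of the reals onto the sequences of reals, and give each point \<open>z\<close> the countable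
  neighbourhood \<open>N z\<close>, the closure of \<open>\<nat> \<union> {z}\<close> under \<open>w \<mapsto> e w n\<close>. The topology is generated by these
  sets together with, for each pair \<open>p = (x, y)\<close> of distinct points, a set \<open>S p\<close> and its complement in
  \<open>N x \<union> N y\<close>, separating \<open>x\<close> from \<open>y\<close>. The sets \<open>S p\<close> are chosen by recursion along a well-order of the
  pairs of type \<open>\<cc>\<close>: each splits every infinite trace, on a neighbourhood of \<open>z \<in> N x \<union> N y\<close> defined so far,
  of the sets \<open>\<nat>\<close>, \<open>{e z (2n)}\<close> and \<open>{e z (2n+1)}\<close>. Only countably many such \<open>z\<close> and fewer than \<open>\<cc>\<close> earlier
  pairs matter, so \<open>\<rr> = \<cc>\<close> provides the splitting set. In the end \<open>z\<close> is an accumulation point of all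
  of these sets that are infinite. Since every two countable sets arise from some \<open>z\<close>, any two infinite
  closed sets meet, and \<open>\<nat>\<close> is dense.
\<close>

text \<open>An injection of \<open>N\<close> into the naturals turns \<open>\<F>\<close> into a
  family of fewer than \<open>reaping_number\<close> infinite sets. Such a family is not reaping,
  and a set splitting all its members pulls back.\<close>

lemma split_few_sets:
  fixes N :: "'a set"
  assumes r: "reaping_number =o continuum" and N: "countable N"
    and \<F>: "\<And>B. B \<in> \<F> \<Longrightarrow> B \<subseteq> N \<and> infinite B" and few: "|\<F>| <o continuum"
  shows "\<exists>S. \<forall>B\<in>\<F>. infinite (B \<inter> S) \<and> infinite (B - S)"
proof -
  obtain g :: "'a \<Rightarrow> nat" where g: "inj_on g N"
    using N by (auto simp: countable_def)
  let ?G = "(`) g ` \<F>"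
  have "|?G| <o reaping_number"
    using card_of_image few ordIso_symmetric[OF r] ordLeq_ordLess_trans ordLess_ordIso_trans
    by blast
  then have "\<not> reaping_family ?G"
    using reaping_number_minimal(2) not_ordLess_ordLeq by blast
  moreover have "\<forall>B\<in>?G. infinite B"
    using \<F> g by (metis (no_types, lifting) finite_imageD imageE inj_on_subset)
  ultimately obtain S where S: "\<And>B. B \<in> \<F> \<Longrightarrow> splits S (g ` B)"
    unfolding reaping_family_def by auto
  have "infinite (B \<inter> g -` S) \<and> infinite (B - g -` S)" if "B \<in> \<F>" for B
  proof -
    have "g ` B \<inter> S = g ` (B \<inter> g -` S)" "g ` B - S = g ` (B - g -` S)"
      by auto
    then show ?thesis
      using S[OF that] unfolding splits_def by (metis finite_imageI)
  qed
  then show ?thesis by blast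
qed

section \<open>Cardinality and coding of the reals\<close>

lemma continuum_eqpoll:
  "|UNIV :: real set| =o continuum" "|UNIV :: (real \<times> real) set| =o continuum"
proof -
  have c: "continuum = |UNIV :: (nat \<Rightarrow> bool) set|"
    by (simp add: continuum_def cexp_def ctwo_def Field_card_of Field_natLeq Func_def)
  have "bij (\<lambda>A::nat set. \<lambda>n. n \<in> A)"
    by (rule bij_betw_byWitness[where f' = Collect]) auto
  then have "(UNIV :: nat set set) \<approx> (UNIV :: (nat \<Rightarrow> bool) set)"
    by (auto simp: eqpoll_def)
  then have "(UNIV :: real set) \<approx> (UNIV :: (nat \<Rightarrow> bool) set)"
    using nat_sets_eqpoll_reals eqpoll_sym eqpoll_trans by blast
  then show 1: "|UNIV :: real set| =o continuum"
    by (simp add: c eqpoll_iff_card_of_ordIso)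
  have "|UNIV \<times> UNIV :: (real \<times> real) set| =o |UNIV :: real set|"
    by (rule card_of_Times_same_infinite) (simp add: infinite_UNIV_char_0)
  then show "|UNIV :: (real \<times> real) set| =o continuum"
    using 1 ordIso_transitive by auto
qed

lemma countable_less_continuum:
  assumes "countable A" shows "|A| <o continuum"
proof -
  have "\<not> |UNIV :: real set| \<le>o |A|"
    using assms uncountable_UNIV_real
    by (meson countable_lepoll lepoll_def card_of_ordLeq)
  then have "|A| <o |UNIV :: real set|"
    by (simp only: not_ordLeq_iff_ordLess[OF card_of_Well_order card_of_Well_order])
  then show ?thesis
    by (rule ordLess_ordIso_trans[OF _ continuum_eqpoll(1)])
qed

lemma surj_real_sequences: "\<exists>e :: real \<Rightarrow> nat \<Rightarrow> real. surj e"
proof -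
  obtain h :: "nat set \<Rightarrow> real" where h: "bij h"
    using nat_sets_eqpoll_reals by (auto simp: eqpoll_def)
  \<comment> \<open>Pairing cuts a set of naturals into countably many rows, and row
    \<open>n\<close> codes the \<open>n\<close>-th term of the sequence.\<close>
  define e where "e x n = h {m. prod_encode (n, m) \<in> inv h x}" for x n
  have "e (h (prod_encode ` {(n, m). m \<in> inv h (f n)})) = f" for f
    using h by (auto simp: e_def bij_is_inj bij_is_surj inj_image_mem_iff inj_prod_encode surj_f_inv_f)
  then have "f \<in> range e" for f
    by (metis rangeI)
  then show ?thesis
    by (intro exI[of _ e]) auto
qed

text \<open>Every finite subset is the set of some list. Lists of a fixed length number at most
  \<open>|B|\<close> since \<open>|B \<times> B|\<close> does not exceed \<open>|B|\<close>, and a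
  union over countably many lengths stays within that bound.\<close>

lemma finite_subsets_of_infinite:
  assumes "infinite B" shows "|{F. F \<subseteq> B \<and> finite F}| \<le>o |B|"
proof -
  have len: "|{xs. set xs \<subseteq> B \<and> length xs = n}| \<le>o |B|" for n
  proof (induction n)
    case 0
    have "{xs. set xs \<subseteq> B \<and> length xs = 0} = {[]}"
      by auto
    then show ?case
      using assms by (metis card_of_singl_ordLeq finite.emptyI)
  next
    case (Suc n)
    let ?L = "{xs. set xs \<subseteq> B \<and> length xs = n}"
    have "{xs. set xs \<subseteq> B \<and> length xs = Suc n} \<subseteq> (\<lambda>(x, xs). x # xs) ` (B \<times> ?L)"
      by (auto simp: length_Suc_conv)
    moreover have "|B \<times> ?L| \<le>o |B|"
      using card_of_Times_ordLeq_infinite_Field[of "|B|" B ?L] assms Suc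
      by (simp add: Field_card_of card_of_card_order_on card_of_mono1)
    ultimately show ?case
      by (meson card_of_image card_of_mono1 ordLeq_transitive)
  qed
  have "{F. F \<subseteq> B \<and> finite F} \<subseteq> set ` (\<Union>n. {xs. set xs \<subseteq> B \<and> length xs = n})"
    by (auto simp: image_iff) (metis finite_list)
  moreover have "|\<Union>n::nat. {xs. set xs \<subseteq> B \<and> length xs = n}| \<le>o |B|"
    using assms len by (intro card_of_UNION_ordLeq_infinite) (auto simp: infinite_iff_card_of_nat)
  ultimately show ?thesis
    by (meson card_of_image card_of_mono1 ordLeq_transitive)
qed

section \<open>Recursive choice of the splitting sets\<close>

definition cell :: "('p \<Rightarrow> 'a set) \<Rightarrow> 'p set \<Rightarrow> 'a \<Rightarrow> 'a set" where
  "cell S F z = {y. \<forall>q\<in>F. y \<in> S q \<longleftrightarrow> z \<in> S q}"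

text \<open>A pair \<open>(z, A)\<close> in \<open>U p\<close> demands that \<open>S p\<close>
  preserve \<open>z\<close> as an accumulation point of \<open>A\<close>. It suffices that
  \<open>S p\<close> splits each infinite trace of \<open>A\<close> on a cell of finitely many
  earlier sets: there are fewer than continuum many such traces, all inside the countable set
  \<open>N p\<close>.\<close>

lemma splitting_assignment:
  fixes N :: "'p \<Rightarrow> 'a set" and U :: "'p \<Rightarrow> ('a \<times> 'a set) set"
  assumes r: "reaping_number =o continuum" and p: "|UNIV :: 'p set| =o continuum"
    and N: "\<And>p. countable (N p)" and U: "\<And>p. countable (U p)"
    and UN: "\<And>p z A. (z, A) \<in> U p \<Longrightarrow> A \<subseteq> N p"
    and ab: "\<And>p. p \<in> Q \<Longrightarrow> a p \<in> N p \<and> a p \<noteq> b p"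
  obtains S where "\<And>p. S p \<subseteq> N p" "\<And>p. p \<in> Q \<Longrightarrow> a p \<in> S p \<and> b p \<notin> S p"
    "\<And>F z A. finite F \<Longrightarrow> infinite A \<Longrightarrow> (\<And>q. q \<in> F \<Longrightarrow> (z, A) \<in> U q) \<Longrightarrow> infinite (A \<inter> cell S F z)"
proof -
  \<comment> \<open>A cardinal order serves as well-order, so that every proper initial segment has
    fewer than continuum many elements.\<close>
  define w where "w = |UNIV :: 'p set|"
  have w: "Card_order w" "Field w = UNIV" "w =o continuum" "Well_order w"
    unfolding w_def using p card_of_Card_order[of UNIV] card_of_Well_order[of UNIV]
    by (simp_all only: Field_card_of)
  have wf: "wf (w - Id)"
    using w(4) by (simp add: well_order_on_def)
  have under: "q \<in> underS w p \<longleftrightarrow> (q, p) \<in> w - Id" for p q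
    by (auto simp: underS_def)
  have inf: "infinite (UNIV :: 'p set)"
    using countable_less_continuum[of "UNIV :: 'p set"] p not_ordLess_ordIso countable_finite by blast
  then obtain C :: "'p set" where C: "infinite C" "countable C"
    using infinite_countable_subset' by blast
  \<comment> \<open>Finite traces impose nothing, so a good \<open>T\<close> exists whatever the
    earlier choices \<open>f\<close> were. That the relevant traces are infinite is shown only after
    the recursion.\<close>
  define good where "good = (\<lambda>f p T. T \<subseteq> N p \<and> (p \<in> Q \<longrightarrow> a p \<in> T \<and> b p \<notin> T) \<and>
     (\<forall>z A F. (z, A) \<in> U p \<longrightarrow> F \<subseteq> underS w p \<longrightarrow> finite F \<longrightarrow> infinite (A \<inter> cell f F z) \<longrightarrow>
        infinite (A \<inter> cell f F z \<inter> T) \<and> infinite (A \<inter> cell f F z - T)))"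
  have "\<exists>T. good f p T" for f p
  proof -
    \<comment> \<open>The countable set \<open>C\<close> is padding: it makes \<open>B\<close>
      infinite even at early stages, so that products and finite subsets are bounded by
      \<open>|B|\<close>.\<close>
    define B where "B = underS w p \<union> C"
    define \<F> where "\<F> = {A \<inter> cell f F z | z A F. (z, A) \<in> U p \<and> F \<subseteq> B \<and> finite F \<and>
      infinite (A \<inter> cell f F z)}"
    have "|C| <o w"
      using countable_less_continuum[OF C(2)] w(3) ordIso_symmetric ordLess_ordIso_trans by blast
    then have B: "|B| <o w" "infinite B"
      using card_of_Un_ordLess_infinite_Field[of w "underS w p" C] inf w card_of_underS[of w p] C
      by (auto simp: B_def)
    have "|U p| \<le>o |B|"
      using U B(2)
      by (meson card_of_ordLeq countable_def infinite_iff_card_of_nat ordLeq_transitive subset_UNIV)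
    then have "|U p \<times> {F. F \<subseteq> B \<and> finite F}| \<le>o |B|"
      using card_of_Times_ordLeq_infinite_Field[of "|B|" "U p"] B(2) finite_subsets_of_infinite[OF B(2)]
      by (simp add: Field_card_of card_of_card_order_on card_of_mono1)
    moreover have "\<F> \<subseteq> (\<lambda>((z, A), F). A \<inter> cell f F z) ` (U p \<times> {F. F \<subseteq> B \<and> finite F})"
      unfolding \<F>_def by force
    ultimately have "|\<F>| \<le>o |B|"
      by (meson card_of_image card_of_mono1 ordLeq_transitive)
    then have "|\<F>| <o continuum"
      using B(1) w(3) ordLeq_ordLess_trans ordLess_ordIso_trans by blast
    moreover have "X \<subseteq> N p \<and> infinite X" if "X \<in> \<F>" for X
      using that UN unfolding \<F>_def by blast
    ultimately obtain S where S: "\<And>X. X \<in> \<F> \<Longrightarrow> infinite (X \<inter> S) \<and> infinite (X - S)"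
      using split_few_sets[OF r N] by metis
    \<comment> \<open>Correcting membership of the two points to be separated changes
      \<open>S \<inter> N p\<close> in at most two places, which does not affect splitting.\<close>
    define T where "T = (if p \<in> Q then insert (a p) (S \<inter> N p) - {b p} else S \<inter> N p)"
    have "infinite (X \<inter> T) \<and> infinite (X - T)" if X: "X \<in> \<F>" for X
    proof -
      have "X \<subseteq> N p" using X UN unfolding \<F>_def by blast
      then have "X \<inter> S \<subseteq> insert (b p) (X \<inter> T)" "X - S \<subseteq> insert (a p) (X - T)"
        by (auto simp: T_def)
      then show ?thesis
        using S[OF X] by (meson finite.insertI finite_subset)
    qed
    moreover have "A \<inter> cell f F z \<in> \<F>"
      if "(z, A) \<in> U p" "F \<subseteq> underS w p" "finite F" "infinite (A \<inter> cell f F z)" for z A F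
      using that unfolding \<F>_def B_def by blast
    ultimately have "good f p T"
      using ab[of p] by (auto simp: good_def T_def)
    then show ?thesis ..
  qed
  \<comment> \<open>Well-founded choice requires that the condition at \<open>p\<close> depend only
    on the values at predecessors of \<open>p\<close>.\<close>
  moreover have "good f p T = good g p T" if "\<And>q. (q, p) \<in> w - Id \<Longrightarrow> f q = g q" for f g p T
  proof -
    have "cell f F z = cell g F z" if "F \<subseteq> underS w p" for F z
    proof -
      have "f q = g q" if "q \<in> F" for q
        using that \<open>F \<subseteq> underS w p\<close> \<open>\<And>q. (q, p) \<in> w - Id \<Longrightarrow> f q = g q\<close> under by blast
      then show ?thesis by (simp add: cell_def)
    qed
    then show ?thesis unfolding good_def by (metis (no_types, lifting))
  qed
  ultimately obtain S where S: "\<And>p. good S p (S p)"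
    using dependent_wf_choice[OF wf, of good] by metis
  show thesis
  proof
    show "S p \<subseteq> N p" "p \<in> Q \<Longrightarrow> a p \<in> S p \<and> b p \<notin> S p" for p
      using S by (auto simp: good_def)
    show "infinite (A \<inter> cell S F z)"
      if "finite F" "infinite A" "\<And>q. q \<in> F \<Longrightarrow> (z, A) \<in> U q" for F z A
      using that
    proof (induction "card F" arbitrary: F)
      case 0
      then show ?case by (auto simp: cell_def)
    next
      case (Suc n)
      then have "F \<noteq> {}" by auto
      have "linear_order_on UNIV w"
        using w by (simp add: well_order_on_def)
      then have wtot: "(x, y) \<in> w \<or> (y, x) \<in> w" for x y
        by (metis UNIV_I linear_order_on_def order_on_defs(1-3) refl_on_def total_on_def)
      have "trans w" using \<open>linear_order_on UNIV w\<close> by (simp add: order_on_defs)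
      \<comment> \<open>The last index of \<open>F\<close> is removed: the trace on the remaining
        cell is infinite by induction, and \<open>S p\<close> was chosen to split it, so the half on
        the side of \<open>z\<close> is infinite.\<close>
      have "\<exists>p\<in>F. \<forall>q\<in>F. (q, p) \<in> w"
        using \<open>finite F\<close> \<open>F \<noteq> {}\<close>
      proof (induction rule: finite_ne_induct)
        case (singleton x)
        then show ?case using wtot[of x x] by auto
      next
        case (insert x F)
        then obtain p where p: "p \<in> F" "\<forall>q\<in>F. (q, p) \<in> w" by blast
        show ?case
        proof (cases "(x, p) \<in> w")
          case True
          then show ?thesis using p by blast
        next
          case False
          then have "(p, x) \<in> w" using wtot by blast
          then have "\<forall>q\<in>insert x F. (q, x) \<in> w"
            using p wtot[of x x] \<open>trans w\<close> by (blast dest: transD)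
          then show ?thesis by blast
        qed
      qed
      then obtain p where p: "p \<in> F" "\<And>q. q \<in> F \<Longrightarrow> (q, p) \<in> w" by blast
      let ?F = "F - {p}"
      have "infinite (A \<inter> cell S ?F z)"
        using Suc p by (intro Suc.hyps) auto
      moreover have "?F \<subseteq> underS w p" using p by (auto simp: underS_def)
      ultimately have "infinite (A \<inter> cell S ?F z \<inter> S p)" "infinite (A \<inter> cell S ?F z - S p)"
        using S[of p] Suc.prems p(1) unfolding good_def by blast+
      moreover have "A \<inter> cell S F z =
          (if z \<in> S p then A \<inter> cell S ?F z \<inter> S p else A \<inter> cell S ?F z - S p)"
        using p(1) by (auto simp: cell_def)
      ultimately show ?case
        by simp
    qed
  qed
qed

text \<open>The last property will make each \<open>N z\<close> open; the one on
  \<open>range (e z)\<close> keeps the sequence coded by \<open>z\<close> inside its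
  neighbourhood.\<close>

lemma countable_closure:
  fixes e :: "'a \<Rightarrow> nat \<Rightarrow> 'a"
  assumes "countable D"
  obtains N where "\<And>z. countable (N z)" "\<And>z. z \<in> N z" "\<And>z. D \<subseteq> N z"
    "\<And>z. range (e z) \<subseteq> N z" "\<And>z y. y \<in> N z \<Longrightarrow> N y \<subseteq> N z"
proof -
  define R where "R = {(z, e z n) | z n. True}"
  define N where "N z = R\<^sup>* `` insert z D" for z
  show thesis
  proof
    have "R `` Y = (\<Union>z\<in>Y. range (e z))" for Y
      by (auto simp: R_def)
    then show "countable (N z)" for z
      unfolding N_def using assms by (intro countable_rtrancl) auto
    show "range (e z) \<subseteq> N z" for z
      by (auto simp: N_def R_def)
    show "N y \<subseteq> N z" if "y \<in> N z" for y z
      using that unfolding N_def by (auto intro: rtrancl_trans)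
  qed (auto simp: N_def)
qed

section \<open>The topology and its properties\<close>

theorem theorem3p7:
  assumes "reaping_number =o continuum"
  shows "\<exists>X :: real topology.
           strongly_anti_Urysohn X \<and> locally_countable_space X \<and> separable_space X \<and>
           crowded_space X \<and> |topspace X| =o continuum"
proof -
  obtain e :: "real \<Rightarrow> nat \<Rightarrow> real" where e: "surj e"
    using surj_real_sequences by blast
  have D: "countable (\<nat> :: real set)" "infinite (\<nat> :: real set)"
    by (auto simp: Nats_def finite_image_iff inj_of_nat)
  obtain N where N: "\<And>z. countable (N z)" "\<And>z. z \<in> N z" "\<And>z. \<nat> \<subseteq> N z"
    "\<And>z. range (e z) \<subseteq> N z" "\<And>z y. y \<in> N z \<Longrightarrow> N y \<subseteq> N z"
    using countable_closure[OF D(1), of e] by metis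
  \<comment> \<open>Even and odd terms carry two interleaved sequences, so that one point can be a
    limit of both. Including \<open>\<nat>\<close> for every \<open>z\<close> yields density and
    crowdedness.\<close>
  define lim where "lim z = {\<nat>, range (\<lambda>n. e z (2 * n)), range (\<lambda>n. e z (2 * n + 1))}" for z
  have lim: "A \<subseteq> N z" if "A \<in> lim z" for A z
    using that N(3,4)[of z] by (auto simp: lim_def)
  define M where "M p = N (fst p) \<union> N (snd p)" for p :: "real \<times> real"
  define V where "V p = Sigma (M p) lim" for p
  have NM: "N z \<subseteq> M p" if "z \<in> M p" for z p
    using that N(5) by (auto simp: M_def)
  obtain S where S: "\<And>p. S p \<subseteq> M p"
    "\<And>p. p \<in> {p. fst p \<noteq> snd p} \<Longrightarrow> fst p \<in> S p \<and> snd p \<notin> S p"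
    "\<And>F z A. finite F \<Longrightarrow> infinite A \<Longrightarrow> (\<And>q. q \<in> F \<Longrightarrow> (z, A) \<in> V q) \<Longrightarrow> infinite (A \<inter> cell S F z)"
  proof (rule splitting_assignment[OF assms continuum_eqpoll(2), of M V "{p. fst p \<noteq> snd p}" fst snd])
    show "countable (M p)" "countable (V p)" for p
      using N(1) by (auto simp: M_def V_def lim_def)
    show "A \<subseteq> M p" if "(z, A) \<in> V p" for p z A
      using that lim NM unfolding V_def by blast
  qed (auto simp: M_def N(2))
  \<comment> \<open>Only indices \<open>q\<close> with \<open>z \<in> M q\<close> may shape a
    neighbourhood of \<open>z\<close>. This keeps each \<open>V q\<close> countable, and
    \<open>S(3)\<close> covers exactly these indices.\<close>
  define op where "op W \<longleftrightarrow> (\<forall>z\<in>W. \<exists>F. finite F \<and> (\<forall>q\<in>F. z \<in> M q) \<and> N z \<inter> cell S F z \<subseteq> W)" for W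
  have "istopology op"
    unfolding istopology_def
  proof (intro conjI allI impI)
    fix W W' assume W: "op W" "op W'"
    show "op (W \<inter> W')"
      unfolding op_def
    proof
      fix z assume "z \<in> W \<inter> W'"
      then obtain F F' where "finite F" "\<forall>q\<in>F. z \<in> M q" "N z \<inter> cell S F z \<subseteq> W"
        "finite F'" "\<forall>q\<in>F'. z \<in> M q" "N z \<inter> cell S F' z \<subseteq> W'"
        using W unfolding op_def by (metis IntD1 IntD2)
      then show "\<exists>F. finite F \<and> (\<forall>q\<in>F. z \<in> M q) \<and> N z \<inter> cell S F z \<subseteq> W \<inter> W'"
        by (intro exI[of _ "F \<union> F'"]) (auto simp: cell_def)
    qed
  next
    fix \<W> assume "\<forall>W\<in>\<W>. op W"
    then show "op (\<Union>\<W>)"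
      unfolding op_def by (meson UnionE Union_upper subset_trans)
  qed
  define X where "X = topology op"
  have op: "openin X W \<longleftrightarrow> op W" for W
    using \<open>istopology op\<close> by (simp add: X_def topology_inverse')
  have opN: "openin X (N z)" for z
    unfolding op op_def using N(5) by (intro ballI exI[of _ "{}"]) auto
  have opS: "openin X (S p)" for p
    unfolding op op_def
  proof
    fix z assume "z \<in> S p"
    then show "\<exists>F. finite F \<and> (\<forall>q\<in>F. z \<in> M q) \<and> N z \<inter> cell S F z \<subseteq> S p"
      using S(1)[of p] by (intro exI[of _ "{p}"]) (auto simp: cell_def)
  qed
  \<comment> \<open>The complement is taken within \<open>M p\<close>, at whose points
    \<open>S p\<close> may be used; both points of the pair lie there, as the Hausdorff property
    needs.\<close>
  have opMS: "openin X (M p - S p)" for p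
    unfolding op op_def
  proof
    fix z assume "z \<in> M p - S p"
    then show "\<exists>F. finite F \<and> (\<forall>q\<in>F. z \<in> M q) \<and> N z \<inter> cell S F z \<subseteq> M p - S p"
      using NM[of z p] by (intro exI[of _ "{p}"]) (auto simp: cell_def)
  qed
  have top: "topspace X = UNIV"
    using opN N(2) openin_subset by blast
  have limit: "infinite (A \<inter> W)" if W: "openin X W" "z \<in> W" and A: "A \<in> lim z" "infinite A" for z A W
  proof -
    obtain F where F: "finite F" "\<forall>q\<in>F. z \<in> M q" "N z \<inter> cell S F z \<subseteq> W"
      using W unfolding op op_def by meson
    have "infinite (A \<inter> cell S F z)"
      using F A by (intro S(3)) (auto simp: V_def)
    moreover have "A \<inter> cell S F z \<subseteq> A \<inter> W"
      using F(3) lim[OF A(1)] by blast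
    ultimately show ?thesis using finite_subset by blast
  qed
  have Nats: "infinite (\<nat> \<inter> W)" if "openin X W" "z \<in> W" for z W
    using that D(2) by (intro limit) (auto simp: lim_def)
  have "isolated_points X = {}"
  proof -
    have "\<not> openin X {z}" for z
      using Nats[of "{z}" z] by auto
    then show ?thesis by (simp add: isolated_points_def)
  qed
  moreover have "Hausdorff_space X"
    unfolding Hausdorff_space_def
  proof (intro allI impI)
    fix x y :: real assume "x \<in> topspace X \<and> y \<in> topspace X \<and> x \<noteq> y"
    then have "x \<in> S (x, y)" "y \<in> M (x, y) - S (x, y)"
      using S(2)[of "(x, y)"] N(2) by (auto simp: M_def)
    then show "\<exists>U V. openin X U \<and> openin X V \<and> x \<in> U \<and> y \<in> V \<and> disjnt U V"
      using opS opMS by (metis disjnt_def Diff_disjoint)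
  qed
  moreover have "A \<inter> B \<noteq> {}"
    if AB: "closedin X A" "infinite A" "closedin X B" "infinite B" for A B
  proof -
    obtain a b :: "nat \<Rightarrow> real" where a: "inj a" "range a \<subseteq> A" and b: "inj b" "range b \<subseteq> B"
      using AB infinite_countable_subset by metis
    \<comment> \<open>This \<open>z\<close> codes the interleaving of \<open>a\<close> and
      \<open>b\<close>, so by \<open>limit\<close> it is an accumulation point of both ranges and
      lies in both closed sets.\<close>
    obtain z where z: "e z = (\<lambda>n. if even n then a (n div 2) else b (n div 2))"
      using e by (metis surj_def)
    have in_closed: "z \<in> A" if "closedin X A" "range f \<subseteq> A" "inj f" "range f \<in> lim z"
      for A and f :: "nat \<Rightarrow> real"
    proof (rule ccontr)
      assume "z \<notin> A"
      then have "infinite (range f \<inter> (topspace X - A))"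
        using that openin_diff[OF openin_topspace that(1)]
        by (intro limit) (auto simp: top range_inj_infinite)
      moreover have "range f \<inter> (topspace X - A) = {}"
        using that(2) by blast
      ultimately show False
        by simp
    qed
    have "range a \<in> lim z" "range b \<in> lim z"
      by (auto simp: lim_def z)
    then show ?thesis
      using in_closed AB a b by blast
  qed
  moreover have "locally_countable_space X"
    unfolding locally_countable_space_def
  proof
    show "\<exists>U B. openin X U \<and> z \<in> U \<and> U \<subseteq> B \<and> B \<subseteq> topspace X \<and> countable B" for z
      using opN N(1,2) top by (intro exI[of _ "N z"]) auto
  qed
  moreover have "separable_space X"
  proof -
    have "\<exists>y\<in>\<nat>. y \<in> W" if "z \<in> W" "openin X W" for z W
      using Nats[OF that(2,1)] by (metis Int_emptyI finite.emptyI)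
    then have "X closure_of \<nat> = topspace X"
      unfolding closure_of_def top by blast
    then show ?thesis
      unfolding separable_space_def using D(1) top by (intro exI[of _ "\<nat>"]) simp
  qed
  moreover have "infinite (topspace X)" "(0::real) \<noteq> 1"
    by (simp_all add: top infinite_UNIV_char_0)
  ultimately show ?thesis
    unfolding strongly_anti_Urysohn_def infinite_Hausdorff_space_def crowded_space_def
    using continuum_eqpoll(1) top
    by (intro exI[of _ X] conjI bexI[of _ 0] bexI[of _ 1]) simp_all
qed

end
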